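(* If $m,n\in\mathbb{N}$ with $n\ge m^2$, then $C(m,n)=\sqrt m$.
   Context: $M_{m,n}$ is the space of $m\times n$ complex matrices with the operator norm, i.e. $M_{m,n}=\mathcal{B}(\mathbb{C}^n,\mathbb{C}^m)$ where $\mathbb{C}^n,\mathbb{C}^m$ carry the $\ell^2$ norm. $D_n\subseteq M_{n,n}$ is the algebra of diagonal $n\times n$ matrices. A right $D_n$-module map on $M_{m,n}$ is a linear map $T\colon M_{m,n}\to M_{m,n}$ with $T(xd)=T(x)d$ for all $x\in M_{m,n}$, $d\in D_n$. For $s,t\in\mathbb{N}$, $M_{s,t}(M_{m,n})$ is identified with $M_{sm,tn}$ and carries the operator norm of that space; $T_{s,t}[x_{ij}]=[Tx_{ij}]$ on $M_{s,t}(M_{m,n})$. $\|T\|=\sup\{\|Tx\|\colon \|x\|\le1\}$ and $\|T\|_{cb}=\sup_{s,t\ge1}\|T_{s,t}\|$. Finally $C(m,n)=\sup\{\|T\|_{cb}\colon T \text{ a right } D_n\text{-module map on } M_{m,n},\ \|T\|\le1\}$. *)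

theory Defs
  imports
    "Jordan_Normal_Form.Matrix"
    "HOL-Analysis.L2_Norm"
    "HOL-Library.Extended_Nonnegative_Real"
begin

definition vec_l2_norm :: "complex vec \<Rightarrow> real" where
  "vec_l2_norm v = L2_set (\<lambda>i. cmod (v $ i)) {..<dim_vec v}"

text \<open>All suprema are taken in \<^typ>\<open>ennreal\<close>, so that they are genuine suprema without any
  prior boundedness argument.\<close>

definition mat_norm :: "complex mat \<Rightarrow> ennreal" where
  "mat_norm A =
    (SUP v \<in> {v \<in> carrier_vec (dim_col A). vec_l2_norm v \<le> 1}. ennreal (vec_l2_norm (A *\<^sub>v v)))"

text \<open>A map on \<open>p \<times> q\<close> matrices is represented by a function on all matrices of which only the
  restriction to \<^term>\<open>carrier_mat p q\<close> matters.\<close>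

definition linear_on_mat :: "nat \<Rightarrow> nat \<Rightarrow> (complex mat \<Rightarrow> complex mat) \<Rightarrow> bool" where
  "linear_on_mat p q T \<longleftrightarrow>
    (\<forall>x \<in> carrier_mat p q. T x \<in> carrier_mat p q) \<and>
    (\<forall>x \<in> carrier_mat p q. \<forall>y \<in> carrier_mat p q. T (x + y) = T x + T y) \<and>
    (\<forall>c. \<forall>x \<in> carrier_mat p q. T (c \<cdot>\<^sub>m x) = c \<cdot>\<^sub>m T x)"

definition diag_algebra :: "nat \<Rightarrow> complex mat set" where
  "diag_algebra n = {d \<in> carrier_mat n n. diagonal_mat d}"

definition right_diag_module_map :: "nat \<Rightarrow> nat \<Rightarrow> (complex mat \<Rightarrow> complex mat) \<Rightarrow> bool" where
  "right_diag_module_map m n T \<longleftrightarrow>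
    linear_on_mat m n T \<and>
    (\<forall>x \<in> carrier_mat m n. \<forall>d \<in> diag_algebra n. T (x * d) = T x * d)"

definition map_norm :: "nat \<Rightarrow> nat \<Rightarrow> (complex mat \<Rightarrow> complex mat) \<Rightarrow> ennreal" where
  "map_norm p q T = (SUP x \<in> {x \<in> carrier_mat p q. mat_norm x \<le> 1}. mat_norm (T x))"

text \<open>The identification of \<open>s \<times> t\<close> block matrices over \<open>m \<times> n\<close> matrices with
  \<open>sm \<times> tn\<close> matrices: the \<open>(k, l)\<close> entry of the block \<open>(i, j)\<close> is the entry
  \<open>(i m + k, j n + l)\<close>, all indices counted from 0.\<close>

definition mat_block :: "nat \<Rightarrow> nat \<Rightarrow> complex mat \<Rightarrow> nat \<Rightarrow> nat \<Rightarrow> complex mat" where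
  "mat_block m n X i j = mat m n (\<lambda>(k, l). X $$ (i * m + k, j * n + l))"

definition mat_of_blocks ::
  "nat \<Rightarrow> nat \<Rightarrow> nat \<Rightarrow> nat \<Rightarrow> (nat \<Rightarrow> nat \<Rightarrow> complex mat) \<Rightarrow> complex mat" where
  "mat_of_blocks s t m n B =
    mat (s * m) (t * n) (\<lambda>(r, c). B (r div m) (c div n) $$ (r mod m, c mod n))"

definition amplification ::
  "nat \<Rightarrow> nat \<Rightarrow> nat \<Rightarrow> nat \<Rightarrow> (complex mat \<Rightarrow> complex mat) \<Rightarrow> complex mat \<Rightarrow> complex mat" where
  "amplification s t m n T X = mat_of_blocks s t m n (\<lambda>i j. T (mat_block m n X i j))"

definition cb_norm :: "nat \<Rightarrow> nat \<Rightarrow> (complex mat \<Rightarrow> complex mat) \<Rightarrow> ennreal" where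
  "cb_norm m n T = (SUP s \<in> {1..}. SUP t \<in> {1..}. map_norm (s * m) (t * n) (amplification s t m n T))"

definition cb_const :: "nat \<Rightarrow> nat \<Rightarrow> ennreal" where
  "cb_const m n = (SUP T \<in> {T. right_diag_module_map m n T \<and> map_norm m n T \<le> 1}. cb_norm m n T)"

end

theory Submission
  imports Defs
begin

text \<open>
  A right module map over the diagonal matrices acts on each column separately,
  \<open>T [x\<^sub>1, \<dots>, x\<^sub>n] = [A\<^sub>1 x\<^sub>1, \<dots>, A\<^sub>n x\<^sub>n]\<close>, and everything rests on this.

  Upper bound, valid for all \<open>m\<close> and \<open>n\<close>. Compose \<open>T\<close> with the projection to the \<open>k\<close>-th row.
  The resulting map into the row space is completely contractive when \<open>T\<close> is contractive
  (\<open>amplified_row_bound\<close>). Indeed, pair the amplified map at a block contraction \<open>X\<close> with a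
  vector \<open>v = (v\<^sub>j\<^sub>l)\<close> and a unit vector \<open>w\<close> of \<open>\<complex>\<^sup>s\<close>, and write \<open>v\<^sub>j\<^sub>l = u\<^sub>j\<^sub>l V\<^sub>l\<close> where
  \<open>V\<^sub>l\<close> is the norm of \<open>(v\<^sub>j\<^sub>l)\<^sub>j\<close>. The weights \<open>u\<close> depend on the column index \<open>l\<close>, yet by the module
  property they can be moved inside \<open>T\<close>: the pairing is the \<open>k\<close>-th entry of \<open>(T x) V\<close>, where \<open>x\<close>
  is the sum of the \<open>w\<^sub>i X\<^sub>i\<^sub>j diag(u\<^sub>j)\<close>. This \<open>x\<close> is a compression of \<open>X\<close>, hence a single \<open>m \<times> n\<close>
  contraction, and the pairing is at most the norm of \<open>V\<close>, which is the norm of \<open>v\<close>. Adding the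
  squares of the \<open>m\<close> rows costs the factor \<open>\<surd>m\<close>.

  Lower bound, where \<open>n \<ge> m\<^sup>2\<close> is used. Let \<open>A\<^sub>l = U\<^sub>l / \<surd>m\<close>, where the \<open>U\<^sub>l\<close> for \<open>l < m\<^sup>2\<close> are the
  discrete Weyl unitaries (products of powers of a shift and of a diagonal matrix of roots of
  unity), and \<open>A\<^sub>l = 0\<close> for the other columns. A contraction with \<open>m\<close> rows has squared
  Hilbert-Schmidt norm at most \<open>m\<close>, so that of its image is at most \<open>1\<close>
  (\<open>map_norm_weyl_map_le_1\<close>). On the other hand, let \<open>\<Omega>\<close> be the maximally entangled unit vector of
  \<open>\<complex>\<^sup>m \<otimes> \<complex>\<^sup>m\<close>. The \<open>m\<^sup>2\<close> vectors \<open>(1 \<otimes> U\<^sub>l)\<^sup>* \<Omega>\<close> are orthonormal, so the matrix with these columns is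
  a contraction (\<open>mat_norm_entangled_mat_le_1\<close>, which is Parseval's identity for the discrete
  Fourier transform). The amplification of \<open>T\<close> maps all of them to the same vector \<open>\<Omega> / \<surd>m\<close>, and a
  matrix with \<open>m\<^sup>2\<close> columns equal to a vector of norm \<open>1 / \<surd>m\<close> has norm \<open>\<surd>m\<close>.
\<close>

section \<open>Finite sums\<close>

lemma cauchy_schwarz_sum:
  fixes f g :: "'a \<Rightarrow> complex"
  shows "(cmod (\<Sum>i\<in>A. f i * g i))\<^sup>2 \<le> (\<Sum>i\<in>A. (cmod (f i))\<^sup>2) * (\<Sum>i\<in>A. (cmod (g i))\<^sup>2)"
proof -
  have "cmod (\<Sum>i\<in>A. f i * g i) \<le> (\<Sum>i\<in>A. \<bar>cmod (f i)\<bar> * \<bar>cmod (g i)\<bar>)"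
    by (rule order_trans[OF norm_sum]) (simp add: norm_mult)
  also have "\<dots> \<le> L2_set (\<lambda>i. cmod (f i)) A * L2_set (\<lambda>i. cmod (g i)) A"
    by (rule L2_set_mult_ineq)
  finally have "(cmod (\<Sum>i\<in>A. f i * g i))\<^sup>2 \<le> (L2_set (\<lambda>i. cmod (f i)) A * L2_set (\<lambda>i. cmod (g i)) A)\<^sup>2"
    by (rule power_mono) simp
  also have "\<dots> = (\<Sum>i\<in>A. (cmod (f i))\<^sup>2) * (\<Sum>i\<in>A. (cmod (g i))\<^sup>2)"
    by (simp add: L2_set_def power_mult_distrib sum_nonneg)
  finally show ?thesis .
qed

lemma sum_lessThan_mult:
  fixes g :: "nat \<Rightarrow> 'a::comm_monoid_add"
  shows "(\<Sum>r<s * m. g r) = (\<Sum>i<s. \<Sum>k<m. g (i * m + k))"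
proof -
  have shift: "sum g {a..<a + m} = (\<Sum>k<m. g (a + k))" for a
    by (rule sum.reindex_bij_witness[of _ "\<lambda>k. a + k" "\<lambda>r. r - a"]) auto
  have "(\<Sum>r<s * m. g r) = (\<Sum>i<s. sum g {i * m..<i * m + m})"
    by (rule sum.nat_group[symmetric])
  also have "\<dots> = (\<Sum>i<s. \<Sum>k<m. g (i * m + k))"
    by (simp add: shift)
  finally show ?thesis .
qed

lemma mult_add_less_mult:
  fixes i k m s :: nat
  assumes "i < s" "k < m"
  shows "i * m + k < s * m"
proof -
  have "i * m + k < Suc i * m" using assms by simp
  also have "\<dots> \<le> s * m" using assms by (intro mult_le_mono1) simp
  finally show ?thesis .
qed

text \<open>This is the self-duality of the \<open>\<ell>\<^sup>2\<close> norm. The extremal \<open>w\<close> is the normalised conjugate of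
  \<open>y\<close>. For \<open>y = 0\<close> it is zero, whence the inequality in the first conclusion.\<close>

lemma ex_unit_pairing:
  fixes y :: "'a \<Rightarrow> complex"
  obtains w where "(\<Sum>i\<in>A. (cmod (w i))\<^sup>2) \<le> 1"
    and "(\<Sum>i\<in>A. w i * y i) = complex_of_real (sqrt (\<Sum>i\<in>A. (cmod (y i))\<^sup>2))"
proof -
  define W where "W = sqrt (\<Sum>i\<in>A. (cmod (y i))\<^sup>2)"
  have W2: "W\<^sup>2 = (\<Sum>i\<in>A. (cmod (y i))\<^sup>2)"
    by (simp add: W_def sum_nonneg)
  define w where "w i = cnj (y i) / complex_of_real W" for i
  have "(\<Sum>i\<in>A. (cmod (w i))\<^sup>2) = W\<^sup>2 / W\<^sup>2"
    unfolding W2 by (simp add: w_def norm_divide power_divide W2 sum_divide_distrib[symmetric])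
  moreover have "\<dots> \<le> 1"
    by simp
  moreover have "(\<Sum>i\<in>A. w i * y i) = (\<Sum>i\<in>A. complex_of_real ((cmod (y i))\<^sup>2)) / complex_of_real W"
    unfolding w_def sum_divide_distrib
    by (intro sum.cong refl, simp only: complex_norm_square) simp
  moreover have "\<dots> = complex_of_real (W\<^sup>2 / W)"
    unfolding W2 by simp
  moreover have "W\<^sup>2 / W = W"
    by (simp add: power2_eq_square)
  ultimately show ?thesis
    using that[of w] unfolding W_def by metis
qed

section \<open>The operator norm in coordinates\<close>

lemma vec_l2_norm_vec: "vec_l2_norm (vec q f) = sqrt (\<Sum>l<q. (cmod (f l))\<^sup>2)"
  by (simp add: vec_l2_norm_def L2_set_def)

lemma vec_l2_norm_mult_mat_vec:
  assumes "A \<in> carrier_mat p q"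
  shows "vec_l2_norm (A *\<^sub>v vec q f) = sqrt (\<Sum>r<p. (cmod (\<Sum>l<q. A $$ (r, l) * f l))\<^sup>2)"
proof -
  have "(A *\<^sub>v vec q f) $ r = (\<Sum>l<q. A $$ (r, l) * f l)" if "r < p" for r
    using assms that by (simp add: scalar_prod_def atLeast0LessThan)
  then show ?thesis
    using assms by (simp add: vec_l2_norm_def L2_set_def)
qed

text \<open>From here on norms of matrices are handled through sums of squares of entries; the
  coordinates of vectors are functions on the natural numbers, so that block indices can be split
  with \<open>sum_lessThan_mult\<close>.\<close>

lemma mat_norm_lower:
  assumes "A \<in> carrier_mat p q" "(\<Sum>l<q. (cmod (f l))\<^sup>2) \<le> 1"
  shows "ennreal (sqrt (\<Sum>r<p. (cmod (\<Sum>l<q. A $$ (r, l) * f l))\<^sup>2)) \<le> mat_norm A"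
  unfolding mat_norm_def vec_l2_norm_mult_mat_vec[OF assms(1), symmetric]
  by (rule SUP_upper) (use assms in \<open>simp add: vec_l2_norm_vec\<close>)

lemma mat_norm_le_iff:
  assumes A: "A \<in> carrier_mat p q" and c: "c \<ge> 0"
  shows "mat_norm A \<le> ennreal c \<longleftrightarrow>
    (\<forall>f. (\<Sum>r<p. (cmod (\<Sum>l<q. A $$ (r, l) * f l))\<^sup>2) \<le> c\<^sup>2 * (\<Sum>l<q. (cmod (f l))\<^sup>2))"
proof
  assume le: "mat_norm A \<le> ennreal c"
  show "\<forall>f. (\<Sum>r<p. (cmod (\<Sum>l<q. A $$ (r, l) * f l))\<^sup>2) \<le> c\<^sup>2 * (\<Sum>l<q. (cmod (f l))\<^sup>2)"
  proof
    fix f :: "nat \<Rightarrow> complex"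
    define V where "V = sqrt (\<Sum>l<q. (cmod (f l))\<^sup>2)"
    have V2: "V\<^sup>2 = (\<Sum>l<q. (cmod (f l))\<^sup>2)"
      by (simp add: V_def sum_nonneg)
    show "(\<Sum>r<p. (cmod (\<Sum>l<q. A $$ (r, l) * f l))\<^sup>2) \<le> c\<^sup>2 * (\<Sum>l<q. (cmod (f l))\<^sup>2)"
    proof (cases "V = 0")
      case True
      then have "(\<Sum>l<q. (cmod (f l))\<^sup>2) = 0" using V2 by simp
      then have "f l = 0" if "l < q" for l
        using that by (subst (asm) sum_nonneg_eq_0_iff) auto
      then show ?thesis by simp
    next
      case False
      define g where "g l = f l / complex_of_real V" for l
      have "(\<Sum>l<q. (cmod (g l))\<^sup>2) = V\<^sup>2 / V\<^sup>2"
        unfolding V2 by (simp add: g_def norm_divide power_divide V2 sum_divide_distrib[symmetric])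
      then have "(\<Sum>l<q. (cmod (g l))\<^sup>2) \<le> 1" by simp
      from order_trans[OF mat_norm_lower[OF A this] le]
      have "sqrt (\<Sum>r<p. (cmod (\<Sum>l<q. A $$ (r, l) * g l))\<^sup>2) \<le> c"
        using c by (simp add: ennreal_le_iff)
      then have g_le: "(\<Sum>r<p. (cmod (\<Sum>l<q. A $$ (r, l) * g l))\<^sup>2) \<le> c\<^sup>2"
        by (rule sqrt_le_D)
      have "(\<Sum>l<q. A $$ (r, l) * f l) = complex_of_real V * (\<Sum>l<q. A $$ (r, l) * g l)" for r
        using False by (simp add: g_def sum_distrib_left)
      then have "(\<Sum>r<p. (cmod (\<Sum>l<q. A $$ (r, l) * f l))\<^sup>2)
          = V\<^sup>2 * (\<Sum>r<p. (cmod (\<Sum>l<q. A $$ (r, l) * g l))\<^sup>2)"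
        by (simp only: norm_mult power_mult_distrib norm_of_real power2_abs sum_distrib_left[symmetric])
      also have "\<dots> \<le> V\<^sup>2 * c\<^sup>2"
        using g_le by (rule mult_left_mono) simp
      finally show ?thesis unfolding V2 by (simp add: mult.commute)
    qed
  qed
next
  assume bound: "\<forall>f. (\<Sum>r<p. (cmod (\<Sum>l<q. A $$ (r, l) * f l))\<^sup>2) \<le> c\<^sup>2 * (\<Sum>l<q. (cmod (f l))\<^sup>2)"
  show "mat_norm A \<le> ennreal c"
    unfolding mat_norm_def
  proof (rule SUP_least)
    fix v assume v: "v \<in> {v \<in> carrier_vec (dim_col A). vec_l2_norm v \<le> 1}"
    then have v_eq: "v = vec q (\<lambda>l. v $ l)" using A by auto
    have "sqrt (\<Sum>l<q. (cmod (v $ l))\<^sup>2) \<le> 1"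
      using v vec_l2_norm_vec[of q "\<lambda>l. v $ l"] v_eq by simp
    then have "c\<^sup>2 * (\<Sum>l<q. (cmod (v $ l))\<^sup>2) \<le> c\<^sup>2 * 1"
      by (intro mult_left_mono) auto
    from order_trans[OF spec[OF bound] this]
    have "(\<Sum>r<p. (cmod (\<Sum>l<q. A $$ (r, l) * v $ l))\<^sup>2) \<le> c\<^sup>2"
      by simp
    then have "vec_l2_norm (A *\<^sub>v vec q (\<lambda>l. v $ l)) \<le> c"
      unfolding vec_l2_norm_mult_mat_vec[OF A] using c by (simp add: real_le_lsqrt sum_nonneg)
    then show "ennreal (vec_l2_norm (A *\<^sub>v v)) \<le> ennreal c"
      using v_eq c by (simp add: ennreal_leI)
  qed
qed

lemmas mat_norm_le_1_iff = mat_norm_le_iff[of _ _ _ 1, simplified]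

lemma amplification_carrier: "amplification s t m n T X \<in> carrier_mat (s * m) (t * n)"
  by (simp add: amplification_def mat_of_blocks_def)

lemma amplification_entry:
  assumes "i < s" "k < m" "j < t" "l < n"
  shows "amplification s t m n T X $$ (i * m + k, j * n + l) = T (mat_block m n X i j) $$ (k, l)"
  using assms by (simp add: amplification_def mat_of_blocks_def mult_add_less_mult)

section \<open>The upper bound\<close>

text \<open>Weights that depend on the column pass through a right module map: multiplying column \<open>l\<close> by
  \<open>c i l\<close> is right multiplication by a diagonal matrix.\<close>

lemma right_diag_module_map_weighted_sum:
  assumes T: "right_diag_module_map m n T" and "finite I"
    and B: "\<And>i. i \<in> I \<Longrightarrow> B i \<in> carrier_mat m n"
  shows "T (mat m n (\<lambda>(k, l). \<Sum>i\<in>I. c i l * B i $$ (k, l)))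
    = mat m n (\<lambda>(k, l). \<Sum>i\<in>I. c i l * T (B i) $$ (k, l))"
  using assms(2) B
proof (induction I rule: finite_induct)
  case empty
  have "T (0 \<cdot>\<^sub>m 0\<^sub>m m n) = 0 \<cdot>\<^sub>m T (0\<^sub>m m n)" "T (0\<^sub>m m n) \<in> carrier_mat m n"
    using T unfolding right_diag_module_map_def linear_on_mat_def by (auto simp del: smult_zero_mat)
  moreover have "(0::complex) \<cdot>\<^sub>m 0\<^sub>m m n = 0\<^sub>m m n"
    by (rule eq_matI) auto
  moreover have "(0::complex) \<cdot>\<^sub>m T (0\<^sub>m m n) = 0\<^sub>m m n"
    using calculation(2) by (intro eq_matI) auto
  ultimately have "T (0\<^sub>m m n) = 0\<^sub>m m n"
    by simp
  moreover have "mat m n (\<lambda>(k, l). 0) = (0\<^sub>m m n :: complex mat)"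
    by (rule eq_matI) auto
  ultimately show ?case by (simp only: sum.empty)
next
  case (insert a I)
  define d where "d = mat n n (\<lambda>(k, l). if k = l then c a l else 0)"
  have d: "d \<in> diag_algebra n" "d \<in> carrier_mat n n"
    by (auto simp: d_def diag_algebra_def diagonal_mat_def)
  have mult_d: "x * d = mat m n (\<lambda>(k, l). c a l * x $$ (k, l))" if "x \<in> carrier_mat m n" for x
    using that
    by (intro eq_matI) (auto simp: d_def scalar_prod_def if_distrib sum.delta mult.commute cong: if_cong)
  let ?S = "mat m n (\<lambda>(k, l). \<Sum>i\<in>I. c i l * B i $$ (k, l))"
  have Ba: "B a \<in> carrier_mat m n" and TBa: "T (B a) \<in> carrier_mat m n"
    using insert.prems T by (auto simp: right_diag_module_map_def linear_on_mat_def)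
  have "mat m n (\<lambda>(k, l). \<Sum>i\<in>insert a I. c i l * B i $$ (k, l)) = B a * d + ?S"
    unfolding mult_d[OF Ba] using insert.hyps by (intro eq_matI) auto
  moreover have "T (B a * d + ?S) = T (B a) * d + T ?S"
    using T d Ba by (simp add: right_diag_module_map_def linear_on_mat_def)
  moreover have "T (B a) * d + T ?S = mat m n (\<lambda>(k, l). \<Sum>i\<in>insert a I. c i l * T (B i) $$ (k, l))"
    unfolding mult_d[OF TBa] using insert by (intro eq_matI) auto
  ultimately show ?case by simp
qed

text \<open>Each row of \<open>T\<close> is completely contractive: an amplified row, tested on vectors \<open>w\<close> and \<open>v\<close>,
  equals a row of \<open>T x\<close> for one contraction \<open>x\<close> of the original size. Since \<open>w\<close> is chosen for the
  given \<open>k\<close>, so is \<open>x\<close>; this is why the argument bounds each row and not the full matrix.\<close>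

lemma amplified_row_bound:
  fixes v :: "nat \<Rightarrow> nat \<Rightarrow> complex"
  assumes T: "right_diag_module_map m n T" and T1: "map_norm m n T \<le> 1"
    and X: "X \<in> carrier_mat (s * m) (t * n)" and X1: "mat_norm X \<le> 1" and k: "k < m"
  shows "(\<Sum>i<s. (cmod (\<Sum>j<t. \<Sum>l<n. T (mat_block m n X i j) $$ (k, l) * v j l))\<^sup>2)
    \<le> (\<Sum>j<t. \<Sum>l<n. (cmod (v j l))\<^sup>2)"
proof -
  define y where "y i = (\<Sum>j<t. \<Sum>l<n. T (mat_block m n X i j) $$ (k, l) * v j l)" for i
  define N where "N = (\<Sum>i<s. (cmod (y i))\<^sup>2)"
  obtain w where w: "(\<Sum>i<s. (cmod (w i))\<^sup>2) \<le> 1"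
    and wy: "(\<Sum>i<s. w i * y i) = complex_of_real (sqrt N)"
    unfolding N_def by (rule ex_unit_pairing)
  \<comment> \<open>Polar decomposition of \<open>v\<close> for each column index: \<open>v j l = u j l * V l\<close>.\<close>
  define V where "V l = sqrt (\<Sum>j<t. (cmod (v j l))\<^sup>2)" for l
  have V2: "(V l)\<^sup>2 = (\<Sum>j<t. (cmod (v j l))\<^sup>2)" for l
    by (simp add: V_def sum_nonneg)
  define u where "u j l = v j l / complex_of_real (V l)" for j l
  have uV: "u j l * complex_of_real (V l) = v j l" if "j < t" for j l
  proof (cases "V l = 0")
    case True
    then have "(\<Sum>j<t. (cmod (v j l))\<^sup>2) = 0" using V2[of l] by simp
    then have "v j l = 0" using that by (subst (asm) sum_nonneg_eq_0_iff) auto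
    then show ?thesis by (simp add: u_def)
  qed (simp add: u_def)
  have u1: "(\<Sum>j<t. (cmod (u j l))\<^sup>2) \<le> 1" for l
  proof -
    have "(\<Sum>j<t. (cmod (u j l))\<^sup>2) = (V l)\<^sup>2 / (V l)\<^sup>2"
      unfolding V2 by (simp add: u_def norm_divide power_divide V2 sum_divide_distrib[symmetric])
    then show ?thesis by simp
  qed
  \<comment> \<open>The compression of \<open>X\<close> by \<open>w\<close> on the left and by the columns of \<open>u\<close> on the right.\<close>
  define x where "x = mat m n (\<lambda>(k, l). \<Sum>(i, j)\<in>{..<s} \<times> {..<t}.
    (w i * u j l) * mat_block m n X i j $$ (k, l))"
  have x: "x \<in> carrier_mat m n" by (simp add: x_def)
  have x_entry: "x $$ (p, l) = (\<Sum>i<s. w i * (\<Sum>j<t. X $$ (i * m + p, j * n + l) * u j l))"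
    if "p < m" "l < n" for p l
    using that by (simp add: x_def mat_block_def sum.cartesian_product[symmetric] sum_distrib_left mult_ac)
  have "T x = mat m n (\<lambda>(k, l). \<Sum>(i, j)\<in>{..<s} \<times> {..<t}.
      (w i * u j l) * T (mat_block m n X i j) $$ (k, l))"
    using right_diag_module_map_weighted_sum[OF T, of "{..<s} \<times> {..<t}"
        "\<lambda>(i, j). mat_block m n X i j" "\<lambda>(i, j) l. w i * u j l"]
    by (simp add: x_def case_prod_unfold mat_block_def)
  then have Tx_entry: "T x $$ (k, l) =
      (\<Sum>i<s. \<Sum>j<t. w i * u j l * T (mat_block m n X i j) $$ (k, l))" if "l < n" for l
    using that k by (simp add: sum.cartesian_product)
  have "mat_norm x \<le> 1"
    unfolding mat_norm_le_1_iff[OF x]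
  proof
    fix f :: "nat \<Rightarrow> complex"
    define h where "h i p = (\<Sum>j<t. \<Sum>l<n. X $$ (i * m + p, j * n + l) * (u j l * f l))" for i p
    have "(\<Sum>l<n. x $$ (p, l) * f l) = (\<Sum>i<s. w i * h i p)" if "p < m" for p
    proof -
      have "(\<Sum>l<n. x $$ (p, l) * f l)
          = (\<Sum>l<n. \<Sum>i<s. \<Sum>j<t. w i * (X $$ (i * m + p, j * n + l) * (u j l * f l)))"
        using that by (simp add: x_entry sum_distrib_left sum_distrib_right mult_ac)
      also have "\<dots> = (\<Sum>i<s. \<Sum>l<n. \<Sum>j<t. w i * (X $$ (i * m + p, j * n + l) * (u j l * f l)))"
        by (rule sum.swap)
      also have "\<dots> = (\<Sum>i<s. w i * h i p)"
        unfolding h_def by (intro sum.cong refl, subst sum.swap) (simp add: sum_distrib_left)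
      finally show ?thesis .
    qed
    then have "(\<Sum>p<m. (cmod (\<Sum>l<n. x $$ (p, l) * f l))\<^sup>2) = (\<Sum>p<m. (cmod (\<Sum>i<s. w i * h i p))\<^sup>2)"
      by simp
    also have "\<dots> \<le> (\<Sum>p<m. 1 * (\<Sum>i<s. (cmod (h i p))\<^sup>2))"
      by (intro sum_mono order_trans[OF cauchy_schwarz_sum] mult_right_mono w sum_nonneg) auto
    also have "\<dots> = (\<Sum>i<s. \<Sum>p<m. (cmod (h i p))\<^sup>2)"
      unfolding mult_1 by (rule sum.swap)
    also have "\<dots> = (\<Sum>r<s * m. (cmod (\<Sum>q<t * n. X $$ (r, q) * (u (q div n) (q mod n) * f (q mod n))))\<^sup>2)"
      by (simp add: h_def sum_lessThan_mult)
    also have "\<dots> \<le> (\<Sum>q<t * n. (cmod (u (q div n) (q mod n) * f (q mod n)))\<^sup>2)"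
      using X1 unfolding mat_norm_le_1_iff[OF X] by (rule spec)
    also have "\<dots> = (\<Sum>j<t. \<Sum>l<n. (cmod (u j l))\<^sup>2 * (cmod (f l))\<^sup>2)"
      by (simp add: sum_lessThan_mult norm_mult power_mult_distrib)
    also have "\<dots> = (\<Sum>l<n. (\<Sum>j<t. (cmod (u j l))\<^sup>2) * (cmod (f l))\<^sup>2)"
      by (subst sum.swap) (simp add: sum_distrib_right)
    also have "\<dots> \<le> (\<Sum>l<n. 1 * (cmod (f l))\<^sup>2)"
      by (intro sum_mono mult_right_mono u1) auto
    finally show "(\<Sum>p<m. (cmod (\<Sum>l<n. x $$ (p, l) * f l))\<^sup>2) \<le> (\<Sum>l<n. (cmod (f l))\<^sup>2)"
      by simp
  qed
  then have "mat_norm (T x) \<le> map_norm m n T"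
    unfolding map_norm_def using x by (intro SUP_upper) auto
  with T1 have Tx1: "mat_norm (T x) \<le> 1" by (rule order_trans[rotated])
  have Tx: "T x \<in> carrier_mat m n"
    using T x by (simp add: right_diag_module_map_def linear_on_mat_def)
  have "(\<Sum>i<s. w i * y i) = (\<Sum>i<s. \<Sum>l<n. \<Sum>j<t. w i * (T (mat_block m n X i j) $$ (k, l) * v j l))"
    unfolding y_def by (intro sum.cong refl, subst sum.swap) (simp add: sum_distrib_left)
  also have "\<dots> = (\<Sum>l<n. \<Sum>i<s. \<Sum>j<t. w i * (T (mat_block m n X i j) $$ (k, l) * v j l))"
    by (rule sum.swap)
  also have "\<dots> = (\<Sum>l<n. T x $$ (k, l) * complex_of_real (V l))"
    by (intro sum.cong refl, simp add: Tx_entry sum_distrib_right, intro sum.cong refl)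
       (simp flip: uV add: mult_ac)
  finally have "(\<Sum>l<n. T x $$ (k, l) * complex_of_real (V l)) = complex_of_real (sqrt N)"
    unfolding wy by (rule sym)
  then have "(cmod (\<Sum>l<n. T x $$ (k, l) * complex_of_real (V l)))\<^sup>2 = N"
    by (simp only: norm_of_real) (simp add: N_def sum_nonneg)
  moreover have "(cmod (\<Sum>l<n. T x $$ (k, l) * complex_of_real (V l)))\<^sup>2
      \<le> (\<Sum>p<m. (cmod (\<Sum>l<n. T x $$ (p, l) * complex_of_real (V l)))\<^sup>2)"
    by (rule member_le_sum) (use k in auto)
  moreover have "\<dots> \<le> (\<Sum>l<n. (cmod (complex_of_real (V l)))\<^sup>2)"
    using Tx1 unfolding mat_norm_le_1_iff[OF Tx] by (rule spec)
  moreover have "\<dots> = (\<Sum>j<t. \<Sum>l<n. (cmod (v j l))\<^sup>2)"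
    by (subst sum.swap) (simp add: V2)
  ultimately show ?thesis
    by (simp add: N_def y_def)
qed

text \<open>The \<open>m\<close> row maps are completely contractive, and the squared norm of a matrix applied to a
  vector is the sum of the contributions of its rows.\<close>

lemma map_norm_amplification_le:
  assumes T: "right_diag_module_map m n T" and T1: "map_norm m n T \<le> 1"
  shows "map_norm (s * m) (t * n) (amplification s t m n T) \<le> ennreal (sqrt (real m))"
  unfolding map_norm_def
proof (rule SUP_least)
  fix X assume "X \<in> {x \<in> carrier_mat (s * m) (t * n). mat_norm x \<le> 1}"
  then have X: "X \<in> carrier_mat (s * m) (t * n)" and X1: "mat_norm X \<le> 1" by auto
  let ?Y = "amplification s t m n T X"
  have "(\<Sum>r<s * m. (cmod (\<Sum>q<t * n. ?Y $$ (r, q) * f q))\<^sup>2) \<le> real m * (\<Sum>q<t * n. (cmod (f q))\<^sup>2)" for f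
  proof -
    have "(\<Sum>r<s * m. (cmod (\<Sum>q<t * n. ?Y $$ (r, q) * f q))\<^sup>2)
        = (\<Sum>i<s. \<Sum>k<m. (cmod (\<Sum>j<t. \<Sum>l<n. T (mat_block m n X i j) $$ (k, l) * f (j * n + l)))\<^sup>2)"
      by (simp add: sum_lessThan_mult amplification_entry)
    also have "\<dots> = (\<Sum>k<m. \<Sum>i<s. (cmod (\<Sum>j<t. \<Sum>l<n. T (mat_block m n X i j) $$ (k, l) * f (j * n + l)))\<^sup>2)"
      by (rule sum.swap)
    also have "\<dots> \<le> (\<Sum>k<m. \<Sum>j<t. \<Sum>l<n. (cmod (f (j * n + l)))\<^sup>2)"
      by (intro sum_mono amplified_row_bound[OF T T1 X X1]) simp
    also have "\<dots> = real m * (\<Sum>q<t * n. (cmod (f q))\<^sup>2)"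
      by (simp add: sum_lessThan_mult)
    finally show ?thesis .
  qed
  then show "mat_norm ?Y \<le> ennreal (sqrt (real m))"
    by (subst mat_norm_le_iff[OF amplification_carrier]) auto
qed

lemma cb_const_le: "cb_const m n \<le> ennreal (sqrt (real m))"
  unfolding cb_const_def cb_norm_def
  by (auto intro!: SUP_least map_norm_amplification_le)

section \<open>The discrete Fourier transform\<close>

lemma bij_betw_add_mod:
  fixes m c :: nat
  shows "bij_betw (\<lambda>k. (c + k) mod m) {..<m} {..<m}"
proof -
  have "inj_on (\<lambda>k. (c + k) mod m) {..<m}"
  proof (rule inj_onI)
    fix a b assume ab: "a \<in> {..<m}" "b \<in> {..<m}" "(c + a) mod m = (c + b) mod m"
    have le: "y \<le> x" if "x < m" "y < m" "(c + x) mod m = (c + y) mod m" for x y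
    proof (rule ccontr)
      assume "\<not> y \<le> x"
      then have "m dvd y - x" "0 < y - x"
        using that(3)[symmetric] by (auto simp: mod_eq_dvd_iff_nat)
      then have "m \<le> y - x" by (rule dvd_imp_le)
      with that show False by simp
    qed
    show "a = b"
      using le[of a b] le[of b a] ab by (intro antisym) auto
  qed
  moreover have "(\<lambda>k. (c + k) mod m) ` {..<m} \<subseteq> {..<m}"
    by auto
  ultimately show ?thesis
    by (simp add: bij_betw_def endo_inj_surj)
qed

definition root_of_unity :: "nat \<Rightarrow> complex" where
  "root_of_unity m = cis (2 * pi / real m)"

lemma root_of_unity_mult_cnj: "root_of_unity m ^ j * cnj (root_of_unity m ^ j) = 1"
  by (simp add: root_of_unity_def cis_cnj power_mult_distrib[symmetric] cis_mult)

lemma norm_root_of_unity_power: "cmod (root_of_unity m ^ j) = 1"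
  by (simp add: root_of_unity_def norm_power)

lemma sum_root_of_unity_powers:
  assumes "a < m" "b < m"
  shows "(\<Sum>i<m. cnj (root_of_unity m ^ (a * i)) * root_of_unity m ^ (b * i)) = (if a = b then of_nat m else 0)"
proof (cases "a = b")
  case True
  then show ?thesis using root_of_unity_mult_cnj by (simp add: mult.commute del: complex_cnj_power)
next
  case False
  define z where "z = cnj (root_of_unity m ^ a) * root_of_unity m ^ b"
  have inj: "inj_on (\<lambda>k. cis (2 * pi * real k / real m)) {..<m}"
    using bij_betw_roots_unity[of m] assms by (simp add: bij_betw_def)
  have pow: "root_of_unity m ^ k = cis (2 * pi * real k / real m)" for k
    by (simp add: root_of_unity_def DeMoivre mult_ac)
  have "root_of_unity m ^ a \<noteq> root_of_unity m ^ b"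
    unfolding pow using inj_onD[OF inj] assms False by auto
  moreover have "root_of_unity m ^ a * z = root_of_unity m ^ b"
    using root_of_unity_mult_cnj[of m a] by (simp add: z_def mult.assoc[symmetric])
  ultimately have "z \<noteq> 1" by auto
  have one: "root_of_unity m ^ m = 1"
    using assms by (simp add: pow)
  have "z ^ m = cnj ((root_of_unity m ^ m) ^ a) * (root_of_unity m ^ m) ^ b"
    unfolding z_def by (simp add: power_mult_distrib mult.commute flip: power_mult)
  then have "z ^ m = 1"
    by (simp add: one)
  have "(\<Sum>i<m. cnj (root_of_unity m ^ (a * i)) * root_of_unity m ^ (b * i)) = (\<Sum>i<m. z ^ i)"
    by (simp add: z_def power_mult_distrib power_mult)
  also have "\<dots> = 0"
    using \<open>z \<noteq> 1\<close> \<open>z ^ m = 1\<close> by (simp add: sum_gp_strict)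
  finally show ?thesis
    using False by simp
qed

lemma parseval_dft:
  fixes v :: "nat \<Rightarrow> complex"
  shows "(\<Sum>i<m. (cmod (\<Sum>a<m. cnj (root_of_unity m ^ (a * i)) * v a))\<^sup>2) = real m * (\<Sum>a<m. (cmod (v a))\<^sup>2)"
proof -
  let ?e = "\<lambda>a i. cnj (root_of_unity m ^ (a * i))"
  have "complex_of_real (\<Sum>i<m. (cmod (\<Sum>a<m. ?e a i * v a))\<^sup>2)
      = (\<Sum>i<m. (\<Sum>a<m. ?e a i * v a) * cnj (\<Sum>b<m. ?e b i * v b))"
    by (simp only: of_real_sum complex_norm_square)
  also have "\<dots> = (\<Sum>i<m. \<Sum>a<m. \<Sum>b<m. v a * cnj (v b) * (?e a i * root_of_unity m ^ (b * i)))"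
    by (simp add: sum_product mult_ac del: complex_cnj_power)
  also have "\<dots> = (\<Sum>a<m. \<Sum>i<m. \<Sum>b<m. v a * cnj (v b) * (?e a i * root_of_unity m ^ (b * i)))"
    by (rule sum.swap)
  also have "\<dots> = (\<Sum>a<m. \<Sum>b<m. \<Sum>i<m. v a * cnj (v b) * (?e a i * root_of_unity m ^ (b * i)))"
    by (rule sum.cong[OF refl], rule sum.swap)
  also have "\<dots> = (\<Sum>a<m. \<Sum>b<m. v a * cnj (v b) * (if a = b then of_nat m else 0))"
    by (intro sum.cong refl)
       (simp add: sum_root_of_unity_powers del: complex_cnj_power flip: sum_distrib_left)
  also have "\<dots> = complex_of_real (real m * (\<Sum>a<m. (cmod (v a))\<^sup>2))"
    by (simp only: of_real_mult of_real_sum complex_norm_square sum_distrib_left)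
       (simp add: if_distrib mult_ac cong: if_cong)
  finally show ?thesis
    by (simp only: of_real_eq_iff)
qed

section \<open>The lower bound\<close>

text \<open>The column index \<open>l = a m + b\<close> encodes a Weyl unitary: column \<open>l\<close> is multiplied by \<open>D\<^sup>a S\<^sup>b / \<surd>m\<close>,
  where \<open>S\<close> is the cyclic shift and \<open>D\<close> is the diagonal matrix of the \<open>m\<close>-th roots of unity.\<close>

definition weyl_map :: "nat \<Rightarrow> nat \<Rightarrow> complex mat \<Rightarrow> complex mat" where
  "weyl_map m n x = mat m n (\<lambda>(k, l). if l < m * m
     then root_of_unity m ^ (l div m * k) * x $$ ((l mod m + k) mod m, l) / complex_of_real (sqrt (real m))
     else 0)"

lemma right_diag_module_map_weyl_map: "right_diag_module_map m n (weyl_map m n)"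
proof -
  have "weyl_map m n (x * d) = weyl_map m n x * d"
    if x: "x \<in> carrier_mat m n" and d: "d \<in> diag_algebra n" for x d
  proof -
    have d': "d \<in> carrier_mat n n" and diag: "\<And>i j. i < n \<Longrightarrow> j < n \<Longrightarrow> i \<noteq> j \<Longrightarrow> d $$ (i, j) = 0"
      using d by (auto simp: diag_algebra_def diagonal_mat_def)
    have mult_d: "(y * d) $$ (k, l) = y $$ (k, l) * d $$ (l, l)"
      if y: "y \<in> carrier_mat m n" and "k < m" "l < n" for y k l
    proof -
      have "(y * d) $$ (k, l) = (\<Sum>i<n. y $$ (k, i) * d $$ (i, l))"
        using y d' that by (simp add: scalar_prod_def atLeast0LessThan)
      also have "\<dots> = (\<Sum>i\<in>{l}. y $$ (k, i) * d $$ (i, l))"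
        using that diag by (intro sum.mono_neutral_right) auto
      finally show ?thesis by simp
    qed
    have wx: "weyl_map m n x \<in> carrier_mat m n"
      by (simp add: weyl_map_def)
    show ?thesis
    proof (rule eq_matI)
      fix k l assume kl: "k < dim_row (weyl_map m n x * d)" "l < dim_col (weyl_map m n x * d)"
      then have "k < m" "l < n" using wx d' by auto
      then show "weyl_map m n (x * d) $$ (k, l) = (weyl_map m n x * d) $$ (k, l)"
        unfolding mult_d[OF wx \<open>k < m\<close> \<open>l < n\<close>]
        by (auto simp: weyl_map_def mult_d[OF x])
    qed (use d' in \<open>auto simp: weyl_map_def\<close>)
  qed
  moreover have "weyl_map m n (x + y) = weyl_map m n x + weyl_map m n y"
    if "x \<in> carrier_mat m n" "y \<in> carrier_mat m n" for x y
    using that by (intro eq_matI) (auto simp: weyl_map_def ring_distribs add_divide_distrib)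
  moreover have "weyl_map m n (c \<cdot>\<^sub>m x) = c \<cdot>\<^sub>m weyl_map m n x" if "x \<in> carrier_mat m n" for c x
    using that by (intro eq_matI) (auto simp: weyl_map_def)
  ultimately show ?thesis
    unfolding right_diag_module_map_def linear_on_mat_def by (auto simp: weyl_map_def)
qed

lemma row_norm_le_1:
  assumes x: "x \<in> carrier_mat m n" and x1: "mat_norm x \<le> 1" and k: "k < m"
  shows "(\<Sum>l<n. (cmod (x $$ (k, l)))\<^sup>2) \<le> 1"
proof -
  define N where "N = (\<Sum>l<n. (cmod (x $$ (k, l)))\<^sup>2)"
  obtain w where w: "(\<Sum>l<n. (cmod (w l))\<^sup>2) \<le> 1"
    and wx: "(\<Sum>l<n. w l * x $$ (k, l)) = complex_of_real (sqrt N)"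
    unfolding N_def by (rule ex_unit_pairing)
  have "N = (cmod (\<Sum>l<n. x $$ (k, l) * w l))\<^sup>2"
    using wx by (simp add: mult.commute N_def sum_nonneg)
  also have "\<dots> \<le> (\<Sum>r<m. (cmod (\<Sum>l<n. x $$ (r, l) * w l))\<^sup>2)"
    by (rule member_le_sum) (use k in auto)
  also have "\<dots> \<le> (\<Sum>l<n. (cmod (w l))\<^sup>2)"
    using x1 unfolding mat_norm_le_1_iff[OF x] by (rule spec)
  finally show ?thesis using w by (simp add: N_def)
qed

text \<open>The operator norm is at most the Hilbert-Schmidt norm. The squared Hilbert-Schmidt norm of a
  contraction with \<open>m\<close> rows is at most \<open>m\<close>, and \<open>weyl_map\<close> lowers it by the factor \<open>m\<close> at least,
  because each column is multiplied by a unitary divided by \<open>\<surd>m\<close> or by zero.\<close>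

lemma map_norm_weyl_map_le_1:
  assumes "m > 0"
  shows "map_norm m n (weyl_map m n) \<le> 1"
  unfolding map_norm_def
proof (rule SUP_least)
  fix x assume "x \<in> {x \<in> carrier_mat m n. mat_norm x \<le> 1}"
  then have x: "x \<in> carrier_mat m n" and x1: "mat_norm x \<le> 1" by auto
  have wx: "weyl_map m n x \<in> carrier_mat m n" by (simp add: weyl_map_def)
  have col: "(\<Sum>k<m. (cmod (weyl_map m n x $$ (k, l)))\<^sup>2) \<le> (\<Sum>k<m. (cmod (x $$ (k, l)))\<^sup>2) / real m"
    if "l < n" for l
  proof (cases "l < m * m")
    case True
    have "(\<Sum>k<m. (cmod (weyl_map m n x $$ (k, l)))\<^sup>2) = (\<Sum>k<m. (cmod (x $$ ((l mod m + k) mod m, l)))\<^sup>2 / real m)"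
      using True that
      by (simp add: weyl_map_def norm_mult norm_divide norm_root_of_unity_power power_divide)
    also have "\<dots> = (\<Sum>k<m. (cmod (x $$ (k, l)))\<^sup>2 / real m)"
      by (rule sum.reindex_bij_betw[OF bij_betw_add_mod])
    finally show ?thesis by (simp add: sum_divide_distrib)
  next
    case False
    with that show ?thesis by (simp add: weyl_map_def sum_nonneg)
  qed
  have frob: "(\<Sum>k<m. \<Sum>l<n. (cmod (weyl_map m n x $$ (k, l)))\<^sup>2) \<le> 1"
  proof -
    have "(\<Sum>k<m. \<Sum>l<n. (cmod (weyl_map m n x $$ (k, l)))\<^sup>2)
        \<le> (\<Sum>l<n. (\<Sum>k<m. (cmod (x $$ (k, l)))\<^sup>2) / real m)"
      by (subst sum.swap) (intro sum_mono col, simp)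
    also have "\<dots> = (\<Sum>k<m. \<Sum>l<n. (cmod (x $$ (k, l)))\<^sup>2) / real m"
      by (subst sum.swap) (simp add: sum_divide_distrib)
    also have "\<dots> \<le> (\<Sum>k<m. 1) / real m"
      by (intro divide_right_mono sum_mono row_norm_le_1[OF x x1]) auto
    finally show ?thesis using assms by simp
  qed
  show "mat_norm (weyl_map m n x) \<le> 1"
    unfolding mat_norm_le_1_iff[OF wx]
  proof
    fix f :: "nat \<Rightarrow> complex"
    have "(\<Sum>k<m. (cmod (\<Sum>l<n. weyl_map m n x $$ (k, l) * f l))\<^sup>2)
        \<le> (\<Sum>k<m. (\<Sum>l<n. (cmod (weyl_map m n x $$ (k, l)))\<^sup>2) * (\<Sum>l<n. (cmod (f l))\<^sup>2))"
      by (intro sum_mono cauchy_schwarz_sum)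
    also have "\<dots> = (\<Sum>k<m. \<Sum>l<n. (cmod (weyl_map m n x $$ (k, l)))\<^sup>2) * (\<Sum>l<n. (cmod (f l))\<^sup>2)"
      by (simp add: sum_distrib_right)
    also have "\<dots> \<le> 1 * (\<Sum>l<n. (cmod (f l))\<^sup>2)"
      by (intro mult_right_mono frob sum_nonneg) auto
    finally show "(\<Sum>k<m. (cmod (\<Sum>l<n. weyl_map m n x $$ (k, l) * f l))\<^sup>2) \<le> (\<Sum>l<n. (cmod (f l))\<^sup>2)"
      by simp
  qed
qed

text \<open>With \<open>\<Omega>\<close> the normalised sum of the \<open>e\<^sub>i \<otimes> e\<^sub>i\<close> in \<open>\<complex>\<^sup>m \<otimes> \<complex>\<^sup>m\<close>, column \<open>l = a m + b\<close> is
  \<open>(1 \<otimes> D\<^sup>a S\<^sup>b)\<^sup>* \<Omega>\<close>, so that \<open>weyl_map\<close> undoes the unitary. The row index \<open>i m + p\<close> stands for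
  \<open>e\<^sub>i \<otimes> e\<^sub>p\<close>. The factor in \<open>1 * n\<close> is the number of block columns.\<close>

definition entangled_mat :: "nat \<Rightarrow> nat \<Rightarrow> complex mat" where
  "entangled_mat m n = mat (m * m) (1 * n) (\<lambda>(r, l).
     if l < m * m \<and> r mod m = (r div m + l mod m) mod m
     then cnj (root_of_unity m ^ (l div m * (r div m))) / complex_of_real (sqrt (real m)) else 0)"

lemma entangled_mat_carrier: "entangled_mat m n \<in> carrier_mat (m * m) (1 * n)"
  by (simp add: entangled_mat_def)

lemma sum_lessThan_restrict:
  fixes g :: "nat \<Rightarrow> 'a::comm_monoid_add"
  assumes "N \<le> n" "\<And>l. N \<le> l \<Longrightarrow> l < n \<Longrightarrow> g l = 0"
  shows "(\<Sum>l<n. g l) = (\<Sum>l<N. g l)"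
  using assms by (intro sum.mono_neutral_right) auto

text \<open>The nonzero columns are orthonormal. For a fixed block row \<open>i\<close> the rows \<open>p\<close> correspond to the
  shifts \<open>b\<close>, and for a fixed shift the dependence on \<open>i\<close> is a discrete Fourier transform in \<open>a\<close>,
  so the norm is computed by Parseval's identity.\<close>

lemma mat_norm_entangled_mat_le_1:
  assumes "m > 0" "m * m \<le> n"
  shows "mat_norm (entangled_mat m n) \<le> 1"
  unfolding mat_norm_le_1_iff[OF entangled_mat_carrier]
proof
  fix f :: "nat \<Rightarrow> complex"
  define h where "h i b = (\<Sum>a<m. cnj (root_of_unity m ^ (a * i)) * f (a * m + b)) / complex_of_real (sqrt (real m))" for i b
  have entry: "entangled_mat m n $$ (i * m + p, a * m + b)
      = (if p = (i + b) mod m then cnj (root_of_unity m ^ (a * i)) / complex_of_real (sqrt (real m)) else 0)"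
    if "i < m" "p < m" "a < m" "b < m" for i p a b
    using that assms mult_add_less_mult[of i m p m] mult_add_less_mult[of a m b m]
    by (simp add: entangled_mat_def)
  have "(\<Sum>l<1 * n. entangled_mat m n $$ (i * m + p, l) * f l) = (\<Sum>b<m. if p = (i + b) mod m then h i b else 0)"
    if "i < m" "p < m" for i p
  proof -
    have "(\<Sum>l<1 * n. entangled_mat m n $$ (i * m + p, l) * f l) = (\<Sum>l<m * m. entangled_mat m n $$ (i * m + p, l) * f l)"
      using assms that mult_add_less_mult[of i m p m]
      by (intro sum_lessThan_restrict) (auto simp: entangled_mat_def)
    also have "\<dots> = (\<Sum>b<m. \<Sum>a<m. entangled_mat m n $$ (i * m + p, a * m + b) * f (a * m + b))"
      unfolding sum_lessThan_mult by (rule sum.swap)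
    also have "\<dots> = (\<Sum>b<m. if p = (i + b) mod m then h i b else 0)"
      using that by (intro sum.cong refl) (auto simp: entry h_def sum_divide_distrib)
    finally show ?thesis .
  qed
  then have "(\<Sum>r<m * m. (cmod (\<Sum>l<1 * n. entangled_mat m n $$ (r, l) * f l))\<^sup>2)
      = (\<Sum>i<m. \<Sum>p<m. (cmod (\<Sum>b<m. if p = (i + b) mod m then h i b else 0))\<^sup>2)"
    by (simp add: sum_lessThan_mult)
  also have "\<dots> = (\<Sum>i<m. \<Sum>b<m. (cmod (h i b))\<^sup>2)"
  proof (rule sum.cong[OF refl])
    fix i
    have "(\<Sum>p<m. (cmod (\<Sum>b<m. if p = (i + b) mod m then h i b else 0))\<^sup>2)
        = (\<Sum>c<m. (cmod (\<Sum>b<m. if (i + c) mod m = (i + b) mod m then h i b else 0))\<^sup>2)"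
      by (rule sum.reindex_bij_betw[OF bij_betw_add_mod, symmetric])
    also have "\<dots> = (\<Sum>c<m. (cmod (\<Sum>b<m. if c = b then h i b else 0))\<^sup>2)"
      using bij_betw_imp_inj_on[OF bij_betw_add_mod[of i m]]
      by (intro sum.cong refl arg_cong[where f = "\<lambda>z. (cmod z)\<^sup>2"] if_cong) (auto dest: inj_onD)
    finally show "(\<Sum>p<m. (cmod (\<Sum>b<m. if p = (i + b) mod m then h i b else 0))\<^sup>2) = (\<Sum>b<m. (cmod (h i b))\<^sup>2)"
      by simp
  qed
  also have "\<dots> = (\<Sum>b<m. \<Sum>i<m. (cmod (h i b))\<^sup>2)"
    by (rule sum.swap)
  also have "\<dots> = (\<Sum>b<m. (\<Sum>i<m. (cmod (\<Sum>a<m. cnj (root_of_unity m ^ (a * i)) * f (a * m + b)))\<^sup>2) / real m)"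
    by (simp add: h_def norm_divide power_divide flip: sum_divide_distrib)
  also have "\<dots> = (\<Sum>b<m. \<Sum>a<m. (cmod (f (a * m + b)))\<^sup>2)"
    unfolding parseval_dft using assms by simp
  also have "\<dots> = (\<Sum>l<m * m. (cmod (f l))\<^sup>2)"
    unfolding sum_lessThan_mult by (rule sum.swap)
  also have "\<dots> \<le> (\<Sum>l<1 * n. (cmod (f l))\<^sup>2)"
    using assms by (intro sum_mono2) auto
  finally show "(\<Sum>r<m * m. (cmod (\<Sum>l<1 * n. entangled_mat m n $$ (r, l) * f l))\<^sup>2) \<le> (\<Sum>l<1 * n. (cmod (f l))\<^sup>2)" .
qed

text \<open>The first \<open>m\<^sup>2\<close> columns of the image all equal \<open>\<Omega> / \<surd>m\<close>, so the unit vector with the equal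
  entries \<open>1 / m\<close> there is sent to \<open>m \<cdot> \<Omega> / \<surd>m = \<surd>m \<Omega>\<close>.\<close>

lemma mat_norm_amplification_weyl_map_ge:
  assumes "m > 0" "m * m \<le> n"
  shows "ennreal (sqrt (real m)) \<le> mat_norm (amplification m 1 m n (weyl_map m n) (entangled_mat m n))"
    (is "_ \<le> mat_norm ?Y")
proof -
  define f where "f l = (if l < m * m then 1 / complex_of_real (real m) else 0)" for l :: nat
  have entry: "?Y $$ (i * m + k, l) = (if l < m * m \<and> i = k then 1 / complex_of_real (real m) else 0)"
    if "i < m" "k < m" "l < n" for i k l
  proof -
    let ?p = "(l mod m + k) mod m"
    have p: "?p < m" using assms by simp
    have "?Y $$ (i * m + k, l) = weyl_map m n (mat_block m n (entangled_mat m n) i 0) $$ (k, l)"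
      using amplification_entry[of i m k m 0 1 l n "weyl_map m n"] that by simp
    also have "\<dots> = (if l < m * m then root_of_unity m ^ (l div m * k)
        * entangled_mat m n $$ (i * m + ?p, l) / complex_of_real (sqrt (real m)) else 0)"
      using that p by (simp add: weyl_map_def mat_block_def)
    also have "entangled_mat m n $$ (i * m + ?p, l) = (if l < m * m \<and> ?p = (l mod m + i) mod m
        then cnj (root_of_unity m ^ (l div m * i)) / complex_of_real (sqrt (real m)) else 0)"
      using that p mult_add_less_mult[of i m ?p m] assms by (simp add: entangled_mat_def add.commute)
    also have "?p = (l mod m + i) mod m \<longleftrightarrow> i = k"
      using bij_betw_imp_inj_on[OF bij_betw_add_mod[of "l mod m" m]] that
      by (auto dest: inj_onD)
    finally show ?thesis
      using root_of_unity_mult_cnj[of m "l div m * i"] assms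
      by (auto simp: real_sqrt_mult_self simp del: complex_cnj_power simp flip: of_real_mult)
  qed
  have "(\<Sum>l<1 * n. (cmod (f l))\<^sup>2) = (\<Sum>l<m * m. (cmod (f l))\<^sup>2)"
    using assms by (intro sum_lessThan_restrict) (auto simp: f_def)
  also have "\<dots> = 1"
    using assms by (simp add: f_def norm_divide power2_eq_square)
  finally have f1: "(\<Sum>l<1 * n. (cmod (f l))\<^sup>2) \<le> 1" by simp
  have row: "(\<Sum>l<1 * n. ?Y $$ (i * m + k, l) * f l) = (if i = k then 1 else 0)"
    if "i < m" "k < m" for i k
  proof -
    have "(\<Sum>l<1 * n. ?Y $$ (i * m + k, l) * f l) = (\<Sum>l<m * m. ?Y $$ (i * m + k, l) * f l)"
      using assms by (intro sum_lessThan_restrict) (auto simp: f_def)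
    also have "\<dots> = (\<Sum>l<m * m. if i = k then 1 / (complex_of_real (real m))\<^sup>2 else 0)"
      using that assms by (intro sum.cong refl) (auto simp: entry f_def power2_eq_square simp del: One_nat_def)
    also have "\<dots> = (if i = k then 1 else 0)"
      using assms by (simp add: power2_eq_square)
    finally show ?thesis .
  qed
  have "(\<Sum>r<m * m. (cmod (\<Sum>l<1 * n. ?Y $$ (r, l) * f l))\<^sup>2) = (\<Sum>i<m. \<Sum>k<m. if i = k then 1 else 0)"
    unfolding sum_lessThan_mult using row by (intro sum.cong refl) auto
  also have "\<dots> = real m"
    by simp
  finally show ?thesis
    using mat_norm_lower[OF amplification_carrier[of m 1 m n] f1, of "weyl_map m n" "entangled_mat m n"]
    by simp
qed

lemma cb_const_ge:
  assumes "m * m \<le> n"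
  shows "ennreal (sqrt (real m)) \<le> cb_const m n"
proof (cases "m = 0")
  case False
  let ?T = "weyl_map m n" and ?X = "entangled_mat m n"
  have "ennreal (sqrt (real m)) \<le> mat_norm (amplification m 1 m n ?T ?X)"
    using False assms by (intro mat_norm_amplification_weyl_map_ge) auto
  also have "\<dots> \<le> map_norm (m * m) (1 * n) (amplification m 1 m n ?T)"
    unfolding map_norm_def using False assms entangled_mat_carrier mat_norm_entangled_mat_le_1
    by (intro SUP_upper) auto
  also have "\<dots> \<le> cb_norm m n ?T"
    unfolding cb_norm_def using False by (intro SUP_upper2[of m] SUP_upper2[of 1]) auto
  also have "\<dots> \<le> cb_const m n"
    unfolding cb_const_def using False right_diag_module_map_weyl_map map_norm_weyl_map_le_1
    by (intro SUP_upper) auto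
  finally show ?thesis .
qed simp

theorem corollary6p5:
  fixes m n :: nat
  assumes "n \<ge> m ^ 2"
  shows "cb_const m n = ennreal (sqrt (real m))"
  using assms cb_const_le cb_const_ge[of m n] by (simp add: power2_eq_square antisym)

end
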